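(* Let $\mathcal{H}$ be a complex Hilbert space, $\mathcal{D}$ a dense subspace of $\mathcal{H}$ and $\Omega$ a sesquilinear form on $\mathcal{D}$. Then there exists at most one norm on $\mathcal{D}$, up to equivalence of norms, with respect to which $\Omega$ is q-closed; that is, if $\Omega$ is q-closed with respect to two norms $\|\cdot\|_\Omega$ and $\|\cdot\|_\Omega'$ on $\mathcal{D}$, then these two norms are equivalent.
   Context: Let $\|\cdot\|$ be the norm of $\mathcal{H}$. A sesquilinear form $\Omega$ on $\mathcal{D}$ is q-closed with respect to a norm $\|\cdot\|_\Omega$ on $\mathcal{D}$ if: (1) there exists $\alpha>0$ with $\|\xi\|\le\alpha\|\xi\|_\Omega$ for all $\xi\in\mathcal{D}$; (2) if $\{\xi_n\}$ is a sequence in $\mathcal{D}$ with $\|\xi_n\|\to0$ and $\|\xi_n-\xi_m\|_\Omega\to0$, then $\|\xi_n\|_\Omega\to0$; (3) $\mathcal{D}$ with the norm $\|\cdot\|_\Omega$ is a reflexive Banach space; (4) there exists $\beta>0$ with $|\Omega(\xi,\eta)|\le\beta\|\xi\|_\Omega\|\eta\|_\Omega$ for all $\xi,\eta\in\mathcal{D}$. *)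

theory Defs
  imports "HOL-Analysis.Analysis" "HOL-Library.Function_Algebras"
begin

section \<open>Complex Hilbert spaces\<close>

text \<open>The real scalar multiplication, norm, metric and topology are those inherited from
  \<^class>\<open>banach\<close>; the axioms tie them to the complex structure.  The inner product is linear in
  its first argument.\<close>

class chilbert_space = banach +
  fixes scaleC :: "complex \<Rightarrow> 'a \<Rightarrow> 'a"
    and cinner :: "'a \<Rightarrow> 'a \<Rightarrow> complex"
  assumes scaleC_add_right: "scaleC c (x + y) = scaleC c x + scaleC c y"
    and scaleC_add_left: "scaleC (c + d) x = scaleC c x + scaleC d x"
    and scaleC_scaleC: "scaleC c (scaleC d x) = scaleC (c * d) x"
    and scaleC_of_real: "scaleC (complex_of_real r) x = r *\<^sub>R x"
    and cinner_add_left: "cinner (x + y) z = cinner x z + cinner y z"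
    and cinner_scaleC_left: "cinner (scaleC c x) y = c * cinner x y"
    and cinner_commute: "cinner x y = cnj (cinner y x)"
    and cinner_ge_zero: "0 \<le> Re (cinner x x)"
    and cinner_eq_zero_iff: "cinner x x = 0 \<longleftrightarrow> x = 0"
    and norm_eq_sqrt_cinner: "norm x = sqrt (Re (cinner x x))"

lemma scaleC_one: "scaleC 1 x = (x :: 'a::chilbert_space)"
  using scaleC_of_real[of 1 x] by simp

global_interpretation complex_vector:
  vector_space "scaleC :: complex \<Rightarrow> 'a \<Rightarrow> 'a::chilbert_space"
  by unfold_locales (simp_all add: scaleC_add_right scaleC_add_left scaleC_scaleC scaleC_one)


section \<open>Norms on complex vector spaces given by a carrier\<close>

text \<open>A normed space is given by a scalar multiplication \<open>sc\<close>, a carrier \<open>V\<close> (a linear subspace)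
  and a function \<open>N\<close>, of which only the values on \<open>V\<close> matter.\<close>

definition norm_on ::
  "(complex \<Rightarrow> 'v::ab_group_add \<Rightarrow> 'v) \<Rightarrow> 'v set \<Rightarrow> ('v \<Rightarrow> real) \<Rightarrow> bool" where
  "norm_on sc V N \<longleftrightarrow>
     (\<forall>x\<in>V. 0 \<le> N x) \<and>
     (\<forall>x\<in>V. N x = 0 \<longleftrightarrow> x = 0) \<and>
     (\<forall>c. \<forall>x\<in>V. N (sc c x) = cmod c * N x) \<and>
     (\<forall>x\<in>V. \<forall>y\<in>V. N (x + y) \<le> N x + N y)"

definition equivalent_norms_on ::
  "'v set \<Rightarrow> ('v \<Rightarrow> real) \<Rightarrow> ('v \<Rightarrow> real) \<Rightarrow> bool" where
  "equivalent_norms_on V N N' \<longleftrightarrow>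
     (\<exists>a>0. \<exists>b>0. \<forall>x\<in>V. a * N x \<le> N' x \<and> N' x \<le> b * N x)"

definition Cauchy_wrt :: "('v::ab_group_add \<Rightarrow> real) \<Rightarrow> (nat \<Rightarrow> 'v) \<Rightarrow> bool" where
  "Cauchy_wrt N X \<longleftrightarrow> (\<forall>e>0. \<exists>M. \<forall>m\<ge>M. \<forall>n\<ge>M. N (X m - X n) < e)"

definition complete_wrt :: "'v::ab_group_add set \<Rightarrow> ('v \<Rightarrow> real) \<Rightarrow> bool" where
  "complete_wrt V N \<longleftrightarrow>
     (\<forall>X. (\<forall>n. X n \<in> V) \<longrightarrow> Cauchy_wrt N X \<longrightarrow> (\<exists>x\<in>V. (\<lambda>n. N (X n - x)) \<longlonglongrightarrow> 0))"

text \<open>Functionals on \<open>V\<close> are represented by functions on the whole type that vanish outside \<open>V\<close>,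
  so that each functional has exactly one representative.  The pointwise operations then make the
  dual space a carrier in the same sense, and the bidual is the dual of the dual.\<close>

definition dual_space ::
  "(complex \<Rightarrow> 'v::ab_group_add \<Rightarrow> 'v) \<Rightarrow> 'v set \<Rightarrow> ('v \<Rightarrow> real) \<Rightarrow> ('v \<Rightarrow> complex) set" where
  "dual_space sc V N =
     {f. (\<forall>x\<in>V. \<forall>y\<in>V. f (x + y) = f x + f y) \<and>
         (\<forall>c. \<forall>x\<in>V. f (sc c x) = c * f x) \<and>
         (\<exists>C. \<forall>x\<in>V. cmod (f x) \<le> C * N x) \<and>
         (\<forall>x. x \<notin> V \<longrightarrow> f x = 0)}"

definition dual_norm :: "'v set \<Rightarrow> ('v \<Rightarrow> real) \<Rightarrow> ('v \<Rightarrow> complex) \<Rightarrow> real" where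
  "dual_norm V N f = (SUP x\<in>{x\<in>V. N x \<le> 1}. cmod (f x))"

definition fun_scale :: "complex \<Rightarrow> ('v \<Rightarrow> complex) \<Rightarrow> 'v \<Rightarrow> complex" where
  "fun_scale c f = (\<lambda>x. c * f x)"

definition bidual_space ::
  "(complex \<Rightarrow> 'v::ab_group_add \<Rightarrow> 'v) \<Rightarrow> 'v set \<Rightarrow> ('v \<Rightarrow> real)
     \<Rightarrow> (('v \<Rightarrow> complex) \<Rightarrow> complex) set" where
  "bidual_space sc V N = dual_space fun_scale (dual_space sc V N) (dual_norm V N)"

definition canonical_embedding ::
  "(complex \<Rightarrow> 'v::ab_group_add \<Rightarrow> 'v) \<Rightarrow> 'v set \<Rightarrow> ('v \<Rightarrow> real)
     \<Rightarrow> 'v \<Rightarrow> ('v \<Rightarrow> complex) \<Rightarrow> complex" where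
  "canonical_embedding sc V N x = (\<lambda>f. if f \<in> dual_space sc V N then f x else 0)"

definition reflexive_wrt ::
  "(complex \<Rightarrow> 'v::ab_group_add \<Rightarrow> 'v) \<Rightarrow> 'v set \<Rightarrow> ('v \<Rightarrow> real) \<Rightarrow> bool" where
  "reflexive_wrt sc V N \<longleftrightarrow> canonical_embedding sc V N ` V = bidual_space sc V N"


section \<open>Sesquilinear forms and q-closedness\<close>

text \<open>Linear in the first argument; values outside \<open>D\<close> are irrelevant.\<close>

definition sesquilinear_on ::
  "'h::chilbert_space set \<Rightarrow> ('h \<Rightarrow> 'h \<Rightarrow> complex) \<Rightarrow> bool" where
  "sesquilinear_on D \<Omega> \<longleftrightarrow>
     (\<forall>x\<in>D. \<forall>y\<in>D. \<forall>z\<in>D. \<Omega> (x + y) z = \<Omega> x z + \<Omega> y z) \<and>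
     (\<forall>x\<in>D. \<forall>y\<in>D. \<forall>z\<in>D. \<Omega> x (y + z) = \<Omega> x y + \<Omega> x z) \<and>
     (\<forall>c. \<forall>x\<in>D. \<forall>y\<in>D. \<Omega> (scaleC c x) y = c * \<Omega> x y) \<and>
     (\<forall>c. \<forall>x\<in>D. \<forall>y\<in>D. \<Omega> x (scaleC c y) = cnj c * \<Omega> x y)"

definition q_closed ::
  "'h::chilbert_space set \<Rightarrow> ('h \<Rightarrow> 'h \<Rightarrow> complex) \<Rightarrow> ('h \<Rightarrow> real) \<Rightarrow> bool" where
  "q_closed D \<Omega> N \<longleftrightarrow>
     (\<exists>\<alpha>>0. \<forall>x\<in>D. norm x \<le> \<alpha> * N x) \<and>
     (\<forall>X. (\<forall>n. X n \<in> D) \<longrightarrow> (\<lambda>n. norm (X n)) \<longlonglongrightarrow> 0 \<longrightarrow> Cauchy_wrt N X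
        \<longrightarrow> (\<lambda>n. N (X n)) \<longlonglongrightarrow> 0) \<and>
     (complete_wrt D N \<and> reflexive_wrt scaleC D N) \<and>
     (\<exists>\<beta>>0. \<forall>x\<in>D. \<forall>y\<in>D. cmod (\<Omega> x y) \<le> \<beta> * N x * N y)"

end

theory Submission
  imports Defs
begin

text \<open>Two norms with respect to which the form is q-closed both dominate the Hilbert norm, so a
  sequence tending to 0 for the first and Cauchy for the second tends to 0 for the second.  Together
  with completeness of the first norm this bounds the second by the first, as in the closed graph
  theorem; by symmetry the norms are equivalent.\<close>

section \<open>Norms on a subspace and their metrics\<close>

locale normed_carrier = vector_space sc
  for sc :: "complex \<Rightarrow> 'v::ab_group_add \<Rightarrow> 'v" +
  fixes V :: "'v set" and N :: "'v \<Rightarrow> real"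
  assumes subspace: "subspace V"
    and norm_on: "norm_on sc V N"
begin

lemma norm_nonneg: "x \<in> V \<Longrightarrow> 0 \<le> N x"
  and norm_eq_0_iff: "x \<in> V \<Longrightarrow> N x = 0 \<longleftrightarrow> x = 0"
  and norm_scale: "x \<in> V \<Longrightarrow> N (sc c x) = cmod c * N x"
  and norm_triangle: "x \<in> V \<Longrightarrow> y \<in> V \<Longrightarrow> N (x + y) \<le> N x + N y"
  using norm_on by (simp_all add: norm_on_def)

lemma norm_minus: "x \<in> V \<Longrightarrow> N (- x) = N x"
  using norm_scale[of x "-1"] by simp

lemma norm_diff_commute: "x \<in> V \<Longrightarrow> y \<in> V \<Longrightarrow> N (x - y) = N (y - x)"
  using norm_minus[of "x - y"] subspace_diff[OF subspace] by simp

lemma norm_triangle_diff: "x \<in> V \<Longrightarrow> y \<in> V \<Longrightarrow> N (x - y) \<le> N x + N y"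
  using norm_triangle[of x "- y"] norm_minus[of y] subspace_neg[OF subspace] by simp

lemma norm_triangle_via:
  assumes "x \<in> V" "y \<in> V" "z \<in> V"
  shows "N (x - z) \<le> N (x - y) + N (y - z)"
  using norm_triangle[of "x - y" "y - z"] subspace_diff[OF subspace] assms by simp

text \<open>The case distinction is needed because \<open>N\<close> is arbitrary outside \<open>V\<close>, while a metric must be
  nonnegative and symmetric on the whole type.\<close>

definition norm_dist :: "'v \<Rightarrow> 'v \<Rightarrow> real" where
  "norm_dist x y = (if x \<in> V \<and> y \<in> V then N (x - y) else 0)"

sublocale metric: Metric_space V norm_dist
proof
  show "0 \<le> norm_dist x y" for x y
    by (simp add: norm_dist_def norm_nonneg subspace_diff[OF subspace])
  show "norm_dist x y = norm_dist y x" for x y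
    by (simp add: norm_dist_def norm_diff_commute)
  show "norm_dist x y = 0 \<longleftrightarrow> x = y" if "x \<in> V" "y \<in> V" for x y
    using that by (simp add: norm_dist_def norm_eq_0_iff subspace_diff[OF subspace])
  show "norm_dist x z \<le> norm_dist x y + norm_dist y z" if "x \<in> V" "y \<in> V" "z \<in> V" for x y z
    using that by (simp add: norm_dist_def norm_triangle_via)
qed

lemma mcomplete_if_complete_wrt:
  assumes "complete_wrt V N"
  shows "metric.mcomplete"
  unfolding metric.mcomplete_def
proof (intro allI impI)
  fix X assume X: "metric.MCauchy X"
  then have XV: "X n \<in> V" for n
    unfolding metric.MCauchy_def by blast
  have "Cauchy_wrt N X"
    using X XV unfolding metric.MCauchy_def Cauchy_wrt_def norm_dist_def by simp
  then obtain x where "x \<in> V" "(\<lambda>n. N (X n - x)) \<longlonglongrightarrow> 0"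
    using assms XV unfolding complete_wrt_def by blast
  then show "\<exists>x. limitin metric.mtopology X x sequentially"
    using XV by (auto simp: metric.limitin_metric_dist_null norm_dist_def)
qed

section \<open>Baire category argument\<close>

text \<open>By the Baire category theorem, the closure of some \<open>N'\<close>-ball contains an \<open>N\<close>-ball around some
  point \<open>x0\<close>; writing \<open>y = (x0 + y) - x0\<close> moves the \<open>N\<close>-ball to the origin, and scaling does the
  rest.\<close>

lemma approx_by_bounded:
  assumes complete: "complete_wrt V N" and N': "norm_on sc V N'"
  obtains K where "K > 0"
    "\<And>y e. y \<in> V \<Longrightarrow> e > 0 \<Longrightarrow> \<exists>z\<in>V. N' z \<le> K * N y \<and> N (y - z) < e"
proof -
  interpret N': normed_carrier sc V N'
    by unfold_locales (use subspace N' in auto)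
  \<comment> \<open>\<open>N'\<close> is not known to be \<open>N\<close>-continuous, so these sets
    need not be \<open>N\<close>-closed; Baire's theorem is applied to their closures.\<close>
  define E where "E n = {x\<in>V. N' x \<le> real n}" for n
  have 0: "0 \<in> V"
    using subspace_0[OF subspace] .
  have "V \<subseteq> (\<Union>n. metric.mtopology closure_of E n)"
  proof
    fix x assume "x \<in> V"
    moreover obtain n where "N' x \<le> real n"
      using real_arch_simple by blast
    moreover have "E n \<subseteq> metric.mtopology closure_of E n"
      by (rule closure_of_subset) (auto simp: E_def)
    ultimately show "x \<in> (\<Union>n. metric.mtopology closure_of E n)"
      by (auto simp: E_def)
  qed
  \<comment> \<open>The union contains the whole space \<open>V\<close>, which is its own interior
    and contains 0.\<close>
  then have "metric.mtopology interior_of (\<Union>n. metric.mtopology closure_of E n) \<noteq> {}"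
    using 0 interior_of_mono[of V _ metric.mtopology] interior_of_topspace[of metric.mtopology]
    by (metis empty_iff metric.topspace_mtopology subsetD)
  then have "\<not> (\<forall>T \<in> range (\<lambda>n. metric.mtopology closure_of E n).
      closedin metric.mtopology T \<and> metric.mtopology interior_of T = {})"
    using metric.metric_Baire_category_alt[OF mcomplete_if_complete_wrt[OF complete],
        of "range (\<lambda>n. metric.mtopology closure_of E n)"]
    by (meson countableI_type countable_image)
  then obtain n where "metric.mtopology interior_of (metric.mtopology closure_of E n) \<noteq> {}"
    by auto
  then obtain x0 r where x0: "x0 \<in> V" and r: "r > 0"
    and ball: "metric.mball x0 r \<subseteq> metric.mtopology closure_of E n"
    by (auto simp: metric.in_interior_of_mball)
  have approx: "\<exists>z\<in>E n. N (x - z) < e" if "x \<in> V" "N (x - x0) < r" "e > 0" for x e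
  proof -
    have "x \<in> metric.mball x0 r"
      using that x0 norm_diff_commute[of x x0] by (simp add: metric.in_mball norm_dist_def)
    then obtain z where "z \<in> E n" "z \<in> metric.mball x e"
      using ball \<open>e > 0\<close> unfolding metric.metric_closure_of by blast
    then show ?thesis
      by (auto simp: norm_dist_def)
  qed
  \<comment> \<open>Differences of two points of \<open>E n\<close> have \<open>N'\<close>-norm at
    most \<open>2 * real n\<close>; adding 1 keeps \<open>C\<close> positive even if
    \<open>n\<close> is 0.\<close>
  define C where "C = 2 * real n + 1"
  have small: "\<exists>z\<in>V. N' z \<le> C \<and> N (y - z) < e" if y: "y \<in> V" "N y < r" and "e > 0" for y e
  proof -
    have V: "x0 + y \<in> V"
      using subspace_add[OF subspace x0 y(1)] .
    \<comment> \<open>The witness is \<open>u - v\<close>: the error \<open>y - (u - v)\<close>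
      equals \<open>(x0 + y - u) - (x0 - v)\<close>, and each part is below
      \<open>e/2\<close>.\<close>
    obtain u v where u: "u \<in> E n" "N (x0 + y - u) < e/2" and v: "v \<in> E n" "N (x0 - v) < e/2"
      using approx[of "x0 + y" "e/2"] approx[of x0 "e/2"] V x0 y r \<open>e > 0\<close> norm_eq_0_iff[OF 0]
      by auto
    have uv: "u \<in> V" "v \<in> V"
      using u v by (auto simp: E_def)
    have "N' (u - v) \<le> C"
      using N'.norm_triangle_diff[OF uv] u v by (auto simp: E_def C_def)
    moreover have "N (y - (u - v)) < e"
      using norm_triangle_diff[of "x0 + y - u" "x0 - v"] V x0 uv u v subspace_diff[OF subspace]
      by (simp add: algebra_simps)
    ultimately show ?thesis
      using subspace_diff[OF subspace uv] by blast
  qed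
  \<comment> \<open>Rescaling a nonzero \<open>y\<close> to \<open>N\<close>-norm
    \<open>r / 2\<close> and back multiplies the bound \<open>C\<close> by
    \<open>2 * N y / r\<close>.\<close>
  define K where "K = 2 * C / r"
  show ?thesis
  proof
    show "K > 0"
      using r by (simp add: K_def C_def)
    fix y e assume y: "y \<in> V" and e: "(e::real) > 0"
    show "\<exists>z\<in>V. N' z \<le> K * N y \<and> N (y - z) < e"
    proof (cases "y = 0")
      case True
      then show ?thesis
        using norm_eq_0_iff[OF 0] N'.norm_eq_0_iff[OF 0] 0 e by (intro bexI[of _ 0]) auto
    next
      case False
      define t where "t = r / (2 * N y)"
      have Ny: "N y > 0"
        using False y norm_nonneg[OF y] norm_eq_0_iff[OF y] by linarith
      then have t: "t > 0"
        using r by (simp add: t_def)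
      have ty: "sc t y \<in> V"
        using subspace_scale[OF subspace y] .
      have "N (sc t y) = t * N y"
        using norm_scale[OF y, of t] t by simp
      also have "\<dots> < r"
        using r Ny by (simp add: t_def)
      finally have "N (sc t y) < r" .
      \<comment> \<open>The tolerance is \<open>t * e\<close> because dividing by \<open>t\<close>
        afterwards turns it into \<open>e\<close>.\<close>
      then obtain z where z: "z \<in> V" "N' z \<le> C" "N (sc t y - z) < t * e"
        using small[OF ty, of "t * e"] t e by auto
      have z': "sc (1/t) z \<in> V"
        using subspace_scale[OF subspace z(1)] .
      have "N' (sc (1/t) z) = N' z / t"
        using N'.norm_scale[OF z(1), of "1/t"] t by (simp add: norm_divide)
      also have "\<dots> \<le> C / t"
        using z t by (simp add: divide_right_mono)
      also have "\<dots> = K * N y"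
        by (simp add: K_def t_def)
      finally have 1: "N' (sc (1/t) z) \<le> K * N y" .
      have "y - sc (1/t) z = sc (1/t) (sc t y - z)"
        using t by (simp add: scale_right_diff_distrib)
      then have "N (y - sc (1/t) z) = N (sc t y - z) / t"
        using norm_scale[of "sc t y - z" "1/t"] subspace_diff[OF subspace ty z(1)] t
        by (simp add: norm_divide)
      also have "\<dots> < e"
        using z t by (simp add: field_simps)
      finally show ?thesis
        using 1 z' by blast
    qed
  qed
qed

section \<open>Successive approximation\<close>

text \<open>Iterating the approximation on the remainders gives a sequence starting at \<open>y\<close> that tends to 0
  for \<open>N\<close> and whose \<open>N'\<close>-increments are dominated by a geometric series.\<close>

lemma norm_bounded_by_complete_norm:
  assumes complete: "complete_wrt V N" and N': "norm_on sc V N'"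
    and closable: "\<And>X. (\<And>n. X n \<in> V) \<Longrightarrow> (\<lambda>n. N (X n)) \<longlonglongrightarrow> 0 \<Longrightarrow> Cauchy_wrt N' X
      \<Longrightarrow> (\<lambda>n. N' (X n)) \<longlonglongrightarrow> 0"
  shows "\<exists>C>0. \<forall>y\<in>V. N' y \<le> C * N y"
proof -
  interpret N': normed_carrier sc V N'
    by unfold_locales (use subspace N' in auto)
  obtain K where K: "K > 0"
    "\<And>y e. y \<in> V \<Longrightarrow> e > 0 \<Longrightarrow> \<exists>z\<in>V. N' z \<le> K * N y \<and> N (y - z) < e"
    using approx_by_bounded[OF complete N'] by blast
  then obtain g where g: "g y e \<in> V" "N' (g y e) \<le> K * N y" "N (y - g y e) < e"
    if "y \<in> V" "e > 0" for y e
    by metis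
  have "N' y \<le> 2 * K * N y" if y: "y \<in> V" for y
  proof (cases "y = 0")
    case True
    then show ?thesis
      using norm_eq_0_iff[OF y] N'.norm_eq_0_iff[OF y] by simp
  next
    case False
    define s where "s = N y"
    have s: "s > 0"
      using False y norm_nonneg[OF y] norm_eq_0_iff[OF y] by (simp add: s_def)
    \<comment> \<open>\<open>R k\<close> is the remainder after \<open>k\<close> corrections. The
      tolerance at step \<open>k\<close> is the bound wanted for \<open>N (R (Suc k))\<close>; it is
      positive because \<open>y\<close> is nonzero.\<close>
    define R where "R = rec_nat y (\<lambda>k u. u - g u (s / 2 ^ Suc k))"
    have R0: "R 0 = y" and RSuc: "R (Suc k) = R k - g (R k) (s / 2 ^ Suc k)" for k
      by (simp_all add: R_def)
    have RV: "R k \<in> V" for k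
      by (induction k) (use y s g subspace_diff[OF subspace] in \<open>simp_all add: R0 RSuc\<close>)
    have RN: "N (R k) \<le> s / 2 ^ k" for k
    proof (cases k)
      case (Suc j)
      then show ?thesis
        using g(3)[OF RV, of "s / 2 ^ Suc j" j] s by (simp add: RSuc less_imp_le)
    qed (simp add: R0 s_def)
    have step: "N' (R k - R (Suc k)) \<le> K * s / 2 ^ k" for k
    proof -
      have "N' (R k - R (Suc k)) \<le> K * N (R k)"
        using g(2)[OF RV, of "s / 2 ^ Suc k"] s by (simp add: RSuc)
      also have "\<dots> \<le> K * (s / 2 ^ k)"
        using RN K(1) by (intro mult_left_mono) auto
      finally show ?thesis by simp
    qed
    \<comment> \<open>The right-hand side is the exact sum of the step bounds from \<open>m\<close>
      to \<open>m + j - 1\<close>. Without the subtracted term the induction would not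
      close.\<close>
    have increment: "N' (R m - R (m + j)) \<le> 2 * K * s / 2 ^ m - 2 * K * s / 2 ^ (m + j)" for m j
    proof (induction j)
      case 0
      then show ?case
        using N'.norm_eq_0_iff[OF subspace_0[OF subspace]] by simp
    next
      case (Suc j)
      have "N' (R m - R (m + Suc j)) \<le> N' (R m - R (m + j)) + N' (R (m + j) - R (Suc (m + j)))"
        using N'.norm_triangle_via[OF RV RV RV] by simp
      also have "\<dots> \<le> (2 * K * s / 2 ^ m - 2 * K * s / 2 ^ (m + j)) + K * s / 2 ^ (m + j)"
        using Suc.IH step by (intro add_mono)
      also have "\<dots> = 2 * K * s / 2 ^ m - 2 * K * s / 2 ^ (m + Suc j)"
        by simp
      finally show ?case .
    qed
    have tail: "N' (R m - R (m + j)) \<le> 2 * K * s / 2 ^ m" for m j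
    proof -
      have "0 \<le> 2 * K * s / 2 ^ (m + j)"
        using K(1) s by simp
      then show ?thesis
        using increment[of m j] by linarith
    qed
    have geometric: "(\<lambda>k. c / 2 ^ k) \<longlonglongrightarrow> 0" for c :: real
      using tendsto_mult_left[OF LIMSEQ_realpow_zero[of "1/2 :: real"], of c]
      by (simp add: power_divide)
    have "(\<lambda>k. N (R k)) \<longlonglongrightarrow> 0"
      using tendsto_sandwich[of "\<lambda>_. 0" "\<lambda>k. N (R k)" sequentially "\<lambda>k. s / 2 ^ k" 0]
        geometric norm_nonneg[OF RV] RN by simp
    moreover have "Cauchy_wrt N' R"
      unfolding Cauchy_wrt_def
    proof (intro allI impI)
      fix e :: real assume "e > 0"
      then obtain M where M: "2 * K * s / 2 ^ M < e / 2"
        using order_tendstoD(2)[OF geometric[of "2 * K * s"], of "e / 2"]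
        by (auto simp: eventually_sequentially)
      have close: "N' (R M - R m) < e / 2" if "m \<ge> M" for m
        using tail[of M "m - M"] M that by simp
      have "N' (R m - R n) < e" if "m \<ge> M" "n \<ge> M" for m n
        using N'.norm_triangle_via[OF RV[of m] RV[of M] RV[of n]]
          N'.norm_diff_commute[OF RV[of m] RV[of M]] close[OF that(1)] close[OF that(2)]
        by linarith
      then show "\<exists>M. \<forall>m\<ge>M. \<forall>n\<ge>M. N' (R m - R n) < e"
        by blast
    qed
    ultimately have "(\<lambda>k. N' (R k)) \<longlonglongrightarrow> 0"
      using closable RV by blast
    \<comment> \<open>Split \<open>y\<close> as \<open>(y - R k) + R k\<close>: the first part has
      \<open>N'\<close>-norm at most \<open>2 * K * s\<close> by \<open>tail\<close> at 0, and the
      second vanishes in the limit.\<close>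
    then have "(\<lambda>k. 2 * K * s + N' (R k)) \<longlonglongrightarrow> 2 * K * s + 0"
      by (intro tendsto_intros)
    moreover have "N' y \<le> 2 * K * s + N' (R k)" for k
      using N'.norm_triangle[of "y - R k" "R k"] tail[of 0 k] y RV[of k]
        subspace_diff[OF subspace] by (simp add: R0)
    ultimately have "N' y \<le> 2 * K * s + 0"
      by (intro LIMSEQ_le_const) auto
    then show ?thesis
      by (simp add: s_def)
  qed
  then show ?thesis
    using K(1) by (intro exI[of _ "2 * K"]) auto
qed

end

section \<open>Comparison of q-closed norms\<close>

text \<open>Domination of the Hilbert norm by \<open>N\<close> turns \<open>N\<close>-null sequences
  into null sequences of the Hilbert space. Condition (2) for \<open>N'\<close> then gives exactly
  the closability that the abstract bound asks for.\<close>

lemma q_closed_norm_bounded: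
  assumes "complex_vector.subspace D"
    and N: "norm_on scaleC D N" and N': "norm_on scaleC D N'"
    and q: "q_closed D \<Omega> N" and q': "q_closed D \<Omega>' N'"
  shows "\<exists>C>0. \<forall>x\<in>D. N' x \<le> C * N x"
proof -
  interpret normed_carrier scaleC D N
    by unfold_locales (use assms in auto)
  obtain \<alpha> where \<alpha>: "\<And>x. x \<in> D \<Longrightarrow> norm x \<le> \<alpha> * N x"
    using q unfolding q_closed_def by blast
  show ?thesis
  proof (rule norm_bounded_by_complete_norm[OF _ N'])
    show "complete_wrt D N"
      using q unfolding q_closed_def by blast
    fix X assume X: "\<And>n. X n \<in> D" "(\<lambda>n. N (X n)) \<longlonglongrightarrow> 0" "Cauchy_wrt N' X"
    have "(\<lambda>n. \<alpha> * N (X n)) \<longlonglongrightarrow> 0"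
      using tendsto_mult_left[OF X(2), of \<alpha>] by simp
    then have "(\<lambda>n. norm (X n)) \<longlonglongrightarrow> 0"
      using tendsto_sandwich[of "\<lambda>_. 0" "\<lambda>n. norm (X n)" sequentially "\<lambda>n. \<alpha> * N (X n)" 0]
        \<alpha> X(1) by simp
    then show "(\<lambda>n. N' (X n)) \<longlonglongrightarrow> 0"
      using q' X unfolding q_closed_def by blast
  qed
qed

theorem theorem3p8:
  fixes D :: "'h::chilbert_space set"
    and \<Omega> :: "'h \<Rightarrow> 'h \<Rightarrow> complex"
    and N N' :: "'h \<Rightarrow> real"
  assumes "complex_vector.subspace D"
    and "closure D = UNIV"
    and "sesquilinear_on D \<Omega>"
    and "norm_on scaleC D N"
    and "norm_on scaleC D N'"
    and "q_closed D \<Omega> N"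
    and "q_closed D \<Omega> N'"
  shows "equivalent_norms_on D N N'"
proof -
  obtain b where b: "b > 0" "\<And>x. x \<in> D \<Longrightarrow> N' x \<le> b * N x"
    using q_closed_norm_bounded assms by blast
  \<comment> \<open>The same bound with the two norms exchanged; its inverse constant gives the
    lower estimate.\<close>
  obtain a where a: "a > 0" "\<And>x. x \<in> D \<Longrightarrow> N x \<le> a * N' x"
    using q_closed_norm_bounded assms by blast
  have "1 / a * N x \<le> N' x" if "x \<in> D" for x
    using a that by (simp add: field_simps)
  then show ?thesis
    unfolding equivalent_norms_on_def using a(1) b
    by (intro exI[of _ "1 / a"] conjI exI[of _ b]) auto
qed

end
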